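(* There are absolute constants such that for every $m,\lambda\ge 1$ there exist a directed graph $G$ with $O(m)$ edges and non-negative edge weights, and a number $d$, such that every collection of subgraphs $G'_1,\dots,G'_z\subseteq G$ that are all $d\lambda$-clustered and that together cover all $d$-paths in $G$ must have total size $\sum_{i=1}^{z}|E(G'_i)|=\Omega\!\left(m\sqrt{m/\lambda}\right)$.
   Context: The length of a path is the sum of its edge weights. A $d$-path is a directed path of length at most $d$. A subgraph $H\subseteq G$ covers a path $p$ if every edge of $p$ belongs to $E(H)$; a collection of subgraphs covers all $d$-paths if every $d$-path of $G$ is covered by at least one subgraph in the collection. A directed graph $H$ is $D$-clustered if every strongly connected component $C$ of $H$ has diameter at most $D$, where the diameter of $C$ is $\max_{x,y\in C}\mathrm{dist}_{H[C]}(x,y)$. *)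

theory Defs
  imports Complex_Main "HOL-Library.Extended_Real"
begin

definition is_digraph :: "(nat set \<times> (nat \<times> nat) set) \<Rightarrow> bool" where
  "is_digraph G \<longleftrightarrow> finite (fst G) \<and> snd G \<subseteq> fst G \<times> fst G"

definition is_subgraph :: "(nat set \<times> (nat \<times> nat) set) \<Rightarrow> (nat set \<times> (nat \<times> nat) set) \<Rightarrow> bool" where
  "is_subgraph H G \<longleftrightarrow> fst H \<subseteq> fst G \<and> snd H \<subseteq> snd G \<and> snd H \<subseteq> fst H \<times> fst H"

definition path_edges :: "nat list \<Rightarrow> (nat \<times> nat) set" where
  "path_edges xs = set (zip xs (tl xs))"

definition is_walk :: "(nat \<times> nat) set \<Rightarrow> nat list \<Rightarrow> bool" where
  "is_walk F xs \<longleftrightarrow> xs \<noteq> [] \<and> path_edges xs \<subseteq> F"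

definition is_dpath :: "(nat set \<times> (nat \<times> nat) set) \<Rightarrow> nat list \<Rightarrow> bool" where
  "is_dpath G xs \<longleftrightarrow> is_walk (snd G) xs \<and> distinct xs \<and> set xs \<subseteq> fst G"

definition wlen :: "(nat \<times> nat \<Rightarrow> real) \<Rightarrow> nat list \<Rightarrow> real" where
  "wlen w xs = sum_list (map w (zip xs (tl xs)))"

definition covers :: "(nat set \<times> (nat \<times> nat) set) \<Rightarrow> nat list \<Rightarrow> bool" where
  "covers H xs \<longleftrightarrow> path_edges xs \<subseteq> snd H"

definition sccs :: "(nat set \<times> (nat \<times> nat) set) \<Rightarrow> nat set set" where
  "sccs H = (\<lambda>x. {y \<in> fst H. (x, y) \<in> (snd H)\<^sup>* \<and> (y, x) \<in> (snd H)\<^sup>*}) ` fst H"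

(* distance from x to y in the induced subgraph H[C] (infinite if unreachable) *)
definition dist_in :: "(nat \<times> nat \<Rightarrow> real) \<Rightarrow> (nat set \<times> (nat \<times> nat) set) \<Rightarrow> nat set \<Rightarrow> nat \<Rightarrow> nat \<Rightarrow> ereal" where
  "dist_in w H C x y = (INF xs \<in> {xs. is_walk (snd H \<inter> (C \<times> C)) xs \<and> set xs \<subseteq> C
                                      \<and> hd xs = x \<and> last xs = y}. ereal (wlen w xs))"

definition diameter :: "(nat \<times> nat \<Rightarrow> real) \<Rightarrow> (nat set \<times> (nat \<times> nat) set) \<Rightarrow> nat set \<Rightarrow> ereal" where
  "diameter w H C = (SUP p \<in> C \<times> C. dist_in w H C (fst p) (snd p))"

definition clustered :: "(nat \<times> nat \<Rightarrow> real) \<Rightarrow> real \<Rightarrow> (nat set \<times> (nat \<times> nat) set) \<Rightarrow> bool" where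
  "clustered w D H \<longleftrightarrow> (\<forall>C \<in> sccs H. diameter w H C \<le> ereal D)"

end

theory Submission
  imports Defs
begin

text \<open>
  Let \<open>k = \<lfloor>sqrt (m / \<lambda>)\<rfloor>\<close> and chain together \<open>k\<close> directed cycles with slightly more than
  \<open>k \<lambda>\<close> edges of weight \<open>1\<close>: between consecutive cycles sits a hub that is entered from every vertex
  of the previous cycle and leads to every vertex of the next one, by edges of weight \<open>0\<close>. The last
  hub starts a tail of \<open>m\<close> edges of weight \<open>0\<close>. Take \<open>d = k\<close>. Since every cycle has diameter
  more than \<open>d \<lambda>\<close>, a clustered subgraph misses an edge of each of the \<open>k\<close> cycles. Given only \<open>k\<close>
  clustered subgraphs, the path that uses in the \<open>i\<close>-th cycle an edge missed by the \<open>i\<close>-th subgraph,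
  and then runs through the tail, has length \<open>d\<close> and is not covered by any of them. Hence more
  than \<open>k\<close> of the subgraphs contain the whole tail.
\<close>

section \<open>Walks\<close>

lemma path_edges_Cons_Cons [simp]: "path_edges (x # y # zs) = insert (x, y) (path_edges (y # zs))"
  by (simp add: path_edges_def)

lemma path_edges_singleton [simp]: "path_edges [x] = {}"
  by (simp add: path_edges_def)

lemma wlen_Cons_Cons [simp]: "wlen w (x # y # zs) = w (x, y) + wlen w (y # zs)"
  by (simp add: wlen_def)

lemma wlen_singleton [simp]: "wlen w [x] = 0"
  by (simp add: wlen_def)

text \<open>The two pieces share the vertex \<open>y\<close>, so no edge is lost at the cut. Walks
  are later cut at hubs in this way.\<close>

lemma path_edges_append:
  "path_edges (xs @ y # ys) = path_edges (xs @ [y]) \<union> path_edges (y # ys)"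
proof (induction xs)
  case (Cons x xs)
  then show ?case by (cases xs) auto
qed simp

lemma wlen_append: "wlen w (xs @ y # ys) = wlen w (xs @ [y]) + wlen w (y # ys)"
proof (induction xs)
  case (Cons x xs)
  then show ?case by (cases xs) auto
qed simp

lemma path_edges_upt: "path_edges [a..<a + Suc l] = (\<lambda>t. (a + t, Suc (a + t))) ` {..<l}"
proof (induction l)
  case (Suc l)
  have "[a..<a + Suc (Suc l)] = [a..<a + l] @ (a + l) # [Suc (a + l)]"
    by simp
  then have "path_edges [a..<a + Suc (Suc l)] = path_edges [a..<a + Suc l] \<union> {(a + l, Suc (a + l))}"
    using path_edges_append[of "[a..<a + l]" "a + l" "[Suc (a + l)]"] by simp
  then show ?case
    using Suc by (simp add: lessThan_Suc)
qed simp

lemma wlen_eq_0: "(\<And>e. e \<in> path_edges xs \<Longrightarrow> w e = 0) \<Longrightarrow> wlen w xs = 0"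
  unfolding wlen_def path_edges_def
  by (simp cong: map_cong add: sum_list_0 del: map_eq_conv)

text \<open>The increments of \<open>f\<close> telescope along the walk, and each is at most the
  weight of its edge.\<close>

lemma potential_le_wlen:
  assumes "is_walk F xs" "\<And>u v. (u, v) \<in> F \<Longrightarrow> f v - f u \<le> w (u, v)"
  shows "f (last xs) - f (hd xs) \<le> wlen w xs"
  using assms(1)
proof (induction xs)
  case (Cons x xs)
  show ?case
  proof (cases xs)
    case (Cons y ys)
    then have "is_walk F xs" "(x, y) \<in> F"
      using Cons.prems by (auto simp: is_walk_def)
    then show ?thesis
      using Cons.IH assms(2)[of x y] Cons by simp
  qed simp
qed (simp add: is_walk_def)

text \<open>Both vertices lie in one strongly connected component, so \<open>D\<close> bounds the
  distance between them there, and the potential bounds it from below. A potential thus refutes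
  clustering without any inspection of walks.\<close>

lemma clustered_potential_le:
  assumes "clustered w D H" "x \<in> fst H" "y \<in> fst H" "(x, y) \<in> (snd H)\<^sup>*" "(y, x) \<in> (snd H)\<^sup>*"
    and "\<And>u v. (u, v) \<in> snd H \<Longrightarrow> f v - f u \<le> w (u, v)"
  shows "f y - f x \<le> D"
proof -
  define C where "C = {z \<in> fst H. (x, z) \<in> (snd H)\<^sup>* \<and> (z, x) \<in> (snd H)\<^sup>*}"
  have "C \<in> sccs H" "x \<in> C" "y \<in> C"
    using assms(2-5) by (auto simp: C_def sccs_def)
  have "ereal (f y - f x) \<le> dist_in w H C x y"
    unfolding dist_in_def
  proof (rule INF_greatest)
    fix xs
    assume "xs \<in> {xs. is_walk (snd H \<inter> C \<times> C) xs \<and> set xs \<subseteq> C \<and> hd xs = x \<and> last xs = y}"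
    then show "ereal (f y - f x) \<le> ereal (wlen w xs)"
      using potential_le_wlen[of "snd H \<inter> C \<times> C" xs f w] assms(6) by auto
  qed
  also have "\<dots> \<le> diameter w H C"
    unfolding diameter_def
    by (rule SUP_upper2[of "(x, y)"]) (use \<open>x \<in> C\<close> \<open>y \<in> C\<close> in auto)
  also have "\<dots> \<le> ereal D"
    using assms(1) \<open>C \<in> sccs H\<close> by (simp add: clustered_def)
  finally show ?thesis by simp
qed

section \<open>A chain of cycles\<close>

text \<open>With \<open>n\<close> vertices per cycle, the vertices are numbered along the chain, so that the \<open>i\<close>-th
  cycle fills the gap between \<open>hub n i\<close> and \<open>hub n (Suc i)\<close>.\<close>

definition hub :: "nat \<Rightarrow> nat \<Rightarrow> nat" where
  "hub n i = i * Suc n"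

definition rim :: "nat \<Rightarrow> nat \<Rightarrow> nat \<Rightarrow> nat" where
  "rim n i j = Suc (hub n i + j)"

definition rim_edge :: "nat \<Rightarrow> nat \<Rightarrow> nat \<Rightarrow> nat \<times> nat" where
  "rim_edge n i j = (rim n i j, rim n i (Suc j mod n))"

definition tail :: "nat \<Rightarrow> nat \<Rightarrow> nat \<Rightarrow> (nat \<times> nat) set" where
  "tail n k m = (\<lambda>t. (hub n k + t, Suc (hub n k + t))) ` {..<m}"

definition chain_edges :: "nat \<Rightarrow> nat \<Rightarrow> nat \<Rightarrow> (nat \<times> nat) set" where
  "chain_edges n k m =
     (\<lambda>(i, j). (hub n i, rim n i j)) ` ({..<k} \<times> {..<n}) \<union>
     (\<lambda>(i, j). rim_edge n i j) ` ({..<k} \<times> {..<n}) \<union>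
     (\<lambda>(i, j). (rim n i j, hub n (Suc i))) ` ({..<k} \<times> {..<n}) \<union> tail n k m"

definition chain :: "nat \<Rightarrow> nat \<Rightarrow> nat \<Rightarrow> nat set \<times> (nat \<times> nat) set" where
  "chain n k m = ({..hub n k + m}, chain_edges n k m)"

text \<open>On the edges of the chain this is 1 exactly on the rim edges: the hubs are the multiples
  of \<open>Suc n\<close> up to \<open>hub n k\<close>, and the bound on \<open>u\<close> discards
  the tail.\<close>

definition chain_weight :: "nat \<Rightarrow> nat \<Rightarrow> nat \<times> nat \<Rightarrow> real" where
  "chain_weight n k = (\<lambda>(u, v). of_bool (u < hub n k \<and> \<not> Suc n dvd u \<and> \<not> Suc n dvd v))"

lemma hub_Suc: "hub n (Suc i) = hub n i + Suc n"
  by (simp add: hub_def)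

lemma hub_mono: "i \<le> i' \<Longrightarrow> hub n i \<le> hub n i'"
  unfolding hub_def by (rule mult_right_mono) auto

lemma rim_less_hub: "j < n \<Longrightarrow> i < i' \<Longrightarrow> rim n i j < hub n i'"
  using hub_mono[of "Suc i" i' n] by (simp add: rim_def hub_Suc)

lemma Suc_dvd_hub: "Suc n dvd hub n i"
  unfolding hub_def by (rule dvd_triv_right)

text \<open>A rim vertex exceeds a multiple of \<open>Suc n\<close> by at least 1 and at most
  \<open>n\<close>.\<close>

lemma not_Suc_dvd_rim: "j < n \<Longrightarrow> \<not> Suc n dvd rim n i j"
  unfolding rim_def hub_def
  by (metis Suc_less_eq add_Suc_right dvd_add_right_iff dvd_triv_right nat_dvd_not_less zero_less_Suc)

lemma chain_weight_nonneg: "chain_weight n k e \<ge> 0"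
  by (cases e) (simp add: chain_weight_def)

lemma chain_weight_from_hub [simp]: "chain_weight n k (hub n i, v) = 0"
  by (simp add: chain_weight_def Suc_dvd_hub)

lemma chain_weight_to_hub [simp]: "chain_weight n k (u, hub n i) = 0"
  by (simp add: chain_weight_def Suc_dvd_hub)

lemma chain_weight_rim_edge [simp]:
  "i < k \<Longrightarrow> j < n \<Longrightarrow> chain_weight n k (rim n i j, rim n i (Suc j mod n)) = 1"
  by (simp add: chain_weight_def not_Suc_dvd_rim rim_less_hub)

lemma chain_weight_tail: "e \<in> tail n k m \<Longrightarrow> chain_weight n k e = 0"
  by (auto simp: chain_weight_def tail_def)

lemma finite_tail: "finite (tail n k m)"
  by (simp add: tail_def)

lemma card_tail: "card (tail n k m) = m"
  unfolding tail_def by (subst card_image) (auto simp: inj_on_def)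

lemma finite_chain_edges: "finite (chain_edges n k m)"
  by (simp add: chain_edges_def finite_tail)

lemma card_chain_edges_le: "card (chain_edges n k m) \<le> 3 * (k * n) + m"
proof -
  have *: "card (f ` ({..<k} \<times> {..<n})) \<le> k * n" for f :: "nat \<times> nat \<Rightarrow> nat \<times> nat"
    using card_image_le[of "{..<k} \<times> {..<n}" f] by (simp add: card_cartesian_product)
  have "card (A \<union> B \<union> C \<union> T) \<le> card A + card B + card C + card T" for A B C T :: "(nat \<times> nat) set"
    using card_Un_le[of A B] card_Un_le[of "A \<union> B" C] card_Un_le[of "A \<union> B \<union> C" T] by linarith
  then have "card (chain_edges n k m) \<le> k * n + k * n + k * n + card (tail n k m)"
    unfolding chain_edges_def
    by (rule order_trans) (intro add_mono * order_refl)
  then show ?thesis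
    by (simp add: card_tail)
qed

lemma chain_edges_cases:
  assumes "(u, v) \<in> chain_edges n k m"
  obtains (enter) i j where "i < k" "j < n" "u = hub n i" "v = rim n i j"
  | (rim) i j where "i < k" "j < n" "u = rim n i j" "v = rim n i (Suc j mod n)"
  | (leave) i j where "i < k" "j < n" "u = rim n i j" "v = hub n (Suc i)"
  | (tail) t where "t < m" "u = hub n k + t" "v = Suc (hub n k + t)"
  using assms unfolding chain_edges_def rim_edge_def tail_def by auto

lemma chain_edgesI:
  assumes "i < k" "j < n"
  shows "(hub n i, rim n i j) \<in> chain_edges n k m" "rim_edge n i j \<in> chain_edges n k m"
    "(rim n i j, hub n (Suc i)) \<in> chain_edges n k m"
proof -
  have "(i, j) \<in> {..<k} \<times> {..<n}"
    using assms by simp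
  from imageI[OF this, of "\<lambda>(i, j). (hub n i, rim n i j)"]
    imageI[OF this, of "\<lambda>(i, j). rim_edge n i j"]
    imageI[OF this, of "\<lambda>(i, j). (rim n i j, hub n (Suc i))"]
  show "(hub n i, rim n i j) \<in> chain_edges n k m" "rim_edge n i j \<in> chain_edges n k m"
    "(rim n i j, hub n (Suc i)) \<in> chain_edges n k m"
    unfolding chain_edges_def by simp_all
qed

lemma is_digraph_chain: "is_digraph (chain n k m)"
proof -
  have "u \<le> hub n k + m \<and> v \<le> hub n k + m" if "(u, v) \<in> chain_edges n k m" for u v
    using that
  proof (cases rule: chain_edges_cases)
    case (enter i j)
    then show ?thesis
      using rim_less_hub[of j n i k] hub_mono[of i k n] by simp
  next
    case (rim i j)
    then show ?thesis
      using rim_less_hub[of j n i k] rim_less_hub[of "Suc j mod n" n i k] by simp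
  next
    case (leave i j)
    then show ?thesis
      using rim_less_hub[of j n i k] hub_mono[of "Suc i" k n] by simp
  qed auto
  then show ?thesis
    by (auto simp: is_digraph_def chain_def)
qed

section \<open>Missing edges in the cycles of clustered subgraphs\<close>

lemma rim_path_rtrancl:
  assumes "\<And>j. j < n \<Longrightarrow> rim_edge n i j \<in> F" "j < n"
  shows "(rim n i 0, rim n i j) \<in> F\<^sup>*"
  using assms(2)
proof (induction j)
  case (Suc j)
  then have "(rim n i j, rim n i (Suc j)) \<in> F"
    using assms(1)[of j] by (simp add: rim_edge_def)
  with Suc show ?case
    by (meson Suc_lessD rtrancl.rtrancl_into_rtrancl)
qed simp

text \<open>A complete cycle would lie in one component of \<open>H\<close>, and getting from its
  first to its last vertex costs at least \<open>n - 1\<close>, whatever other edges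
  \<open>H\<close> has. A potential that counts the position on the cycle shows this.\<close>

lemma clustered_misses_rim_edge:
  assumes "is_subgraph H (chain n k m)" "clustered (chain_weight n k) D H" "D < real n - 1"
    and "i < k" "0 < n"
  obtains j where "j < n" "rim_edge n i j \<notin> snd H"
proof (rule ccontr)
  assume "\<not> thesis"
  then have all: "rim_edge n i j \<in> snd H" if "j < n" for j
    using that \<open>\<And>j. j < n \<Longrightarrow> rim_edge n i j \<notin> snd H \<Longrightarrow> thesis\<close> by blast
  have sub: "snd H \<subseteq> chain_edges n k m" "snd H \<subseteq> fst H \<times> fst H"
    using assms(1) by (auto simp: is_subgraph_def chain_def)
  \<comment> \<open>The value on the vertices before the cycle is the largest one and that on the vertices after it
    is the smallest one, so only the edges of the \<open>i\<close>-th cycle can increase \<open>f\<close>.\<close>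
  define f :: "nat \<Rightarrow> real" where
    "f v = (if v \<le> hub n i then real n - 1 else if hub n (Suc i) \<le> v then 0
            else real v - real (hub n i) - 1)" for v
  have f_before: "f v = real n - 1" if "v \<le> hub n i" for v
    using that by (simp add: f_def)
  have f_after: "f v = 0" if "hub n (Suc i) \<le> v" for v
    using that by (simp add: f_def hub_Suc)
  have f_rim: "f (rim n i j) = real j" if "j < n" for j
    using that by (simp add: f_def rim_def hub_Suc)
  have f_le: "f v \<le> real n - 1" for v
    using \<open>0 < n\<close> by (auto simp: f_def hub_Suc)
  have f_ge: "0 \<le> f v" for v
    using \<open>0 < n\<close> by (auto simp: f_def)
  have f_edge: "f v - f u \<le> chain_weight n k (u, v)" if "(u, v) \<in> snd H" for u v
  proof -
    have "f v - f u \<le> 0 \<or> (\<exists>j<n. u = rim n i j \<and> v = rim n i (Suc j mod n))"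
      using subsetD[OF sub(1) that]
    proof (cases rule: chain_edges_cases)
      case (enter i' j)
      have "f v - f u \<le> 0"
      proof (cases "i' \<le> i")
        case True
        then show ?thesis
          using f_le[of v] f_before[of u] hub_mono[of i' i n] enter by simp
      next
        case False
        then have "hub n (Suc i) \<le> u"
          using enter hub_mono[of "Suc i" i' n] by simp
        then show ?thesis
          using f_after[of u] f_after[of v] enter by (simp add: rim_def)
      qed
      then show ?thesis ..
    next
      case (rim i' j)
      consider "i' < i" | "i' = i" | "i < i'" by linarith
      then show ?thesis
      proof cases
        case 1
        then show ?thesis
          using f_le[of v] f_before[of u] rim_less_hub[of j n i' i] rim by simp
      next
        case 2
        then show ?thesis using rim by blast
      next
        case 3
        then have "hub n (Suc i) \<le> v"
          using rim hub_mono[of "Suc i" i' n] by (simp add: rim_def)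
        then show ?thesis
          using f_ge[of u] f_after[of v] by simp
      qed
    next
      case (leave i' j)
      have "f v - f u \<le> 0"
      proof (cases "i' < i")
        case True
        then show ?thesis
          using f_le[of v] f_before[of u] rim_less_hub[of j n i' i] leave by simp
      next
        case False
        then show ?thesis
          using f_ge[of u] f_after[of v] hub_mono[of "Suc i" "Suc i'" n] leave by simp
      qed
      then show ?thesis ..
    next
      case (tail t)
      then show ?thesis
        using f_ge[of u] f_after[of v] hub_mono[of "Suc i" k n] \<open>i < k\<close> by simp
    qed
    then show ?thesis
    proof
      assume "f v - f u \<le> 0"
      then show ?thesis
        using chain_weight_nonneg[of n k "(u, v)"] by simp
    next
      assume "\<exists>j<n. u = rim n i j \<and> v = rim n i (Suc j mod n)"
      then obtain j where j: "j < n" "u = rim n i j" "v = rim n i (Suc j mod n)" by blast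
      \<comment> \<open>This covers the closing edge too, along which \<open>f\<close> falls back to
        0.\<close>
      have "real (Suc j mod n) \<le> real j + 1"
        by (metis Suc_eq_plus1 mod_less_eq_dividend of_nat_1 of_nat_add of_nat_mono)
      then show ?thesis
        using j f_rim[of j] f_rim[of "Suc j mod n"] \<open>i < k\<close> by simp
    qed
  qed
  \<comment> \<open>The closing edge leads back from the last vertex to the first, which puts both
    in one component.\<close>
  have last: "(rim n i (n - 1), rim n i 0) \<in> snd H"
    using all[of "n - 1"] \<open>0 < n\<close> by (simp add: rim_edge_def)
  have "f (rim n i (n - 1)) - f (rim n i 0) \<le> D"
  proof (rule clustered_potential_le[OF assms(2)])
    show "rim n i 0 \<in> fst H" "rim n i (n - 1) \<in> fst H"
      using last sub by auto
    show "(rim n i 0, rim n i (n - 1)) \<in> (snd H)\<^sup>*"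
      using all \<open>0 < n\<close> by (intro rim_path_rtrancl) auto
    show "(rim n i (n - 1), rim n i 0) \<in> (snd H)\<^sup>*"
      using last by blast
  qed (rule f_edge)
  then show False
    using f_rim[of "n - 1"] f_rim[of 0] \<open>0 < n\<close> assms(3) by (simp add: of_nat_diff)
qed

section \<open>Paths with a prescribed edge in each cycle\<close>

text \<open>The list stops just before \<open>hub n k\<close>, so that the tail, which starts at
  this hub, can be appended without repeating it.\<close>

fun rim_walk :: "nat \<Rightarrow> (nat \<Rightarrow> nat) \<Rightarrow> nat \<Rightarrow> nat list" where
  "rim_walk n g 0 = []"
| "rim_walk n g (Suc i) = rim_walk n g i @ [hub n i, rim n i (g i), rim n i (Suc (g i) mod n)]"

lemma path_edges_rim_walk:
  "path_edges (rim_walk n g k @ [hub n k]) =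
     (\<Union>i<k. {(hub n i, rim n i (g i)), rim_edge n i (g i), (rim n i (Suc (g i) mod n), hub n (Suc i))})"
proof (induction k)
  case (Suc k)
  have "path_edges (rim_walk n g (Suc k) @ [hub n (Suc k)]) = path_edges (rim_walk n g k @ [hub n k]) \<union>
      path_edges [hub n k, rim n k (g k), rim n k (Suc (g k) mod n), hub n (Suc k)]"
    using path_edges_append[of "rim_walk n g k" "hub n k"
        "[rim n k (g k), rim n k (Suc (g k) mod n), hub n (Suc k)]"] by simp
  then show ?case
    using Suc by (simp add: lessThan_Suc rim_edge_def Un_commute)
qed simp

text \<open>Each cycle contributes its one rim edge. The weights depend on the total number
  \<open>k'\<close> of cycles, which stays fixed while the induction runs over the prefix length
  \<open>k\<close>.\<close>

lemma wlen_rim_walk: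
  assumes "\<And>i. i < k \<Longrightarrow> g i < n" "k \<le> k'"
  shows "wlen (chain_weight n k') (rim_walk n g k @ [hub n k]) = real k"
  using assms
proof (induction k)
  case (Suc k)
  have "wlen (chain_weight n k') (rim_walk n g (Suc k) @ [hub n (Suc k)]) =
      wlen (chain_weight n k') (rim_walk n g k @ [hub n k]) +
      wlen (chain_weight n k') [hub n k, rim n k (g k), rim n k (Suc (g k) mod n), hub n (Suc k)]"
    using wlen_append[of "chain_weight n k'" "rim_walk n g k" "hub n k"
        "[rim n k (g k), rim n k (Suc (g k) mod n), hub n (Suc k)]"] by simp
  then show ?case
    using Suc by simp
qed simp

text \<open>The bound by \<open>hub n k\<close> is carried along because the three vertices added
  next are no smaller than that hub. With \<open>2 \<le> n\<close> the two ends of a rim edge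
  differ.\<close>

lemma rim_walk_distinct:
  assumes "\<And>i. i < k \<Longrightarrow> g i < n" "2 \<le> n"
  shows "distinct (rim_walk n g k) \<and> set (rim_walk n g k) \<subseteq> {..<hub n k}"
  using assms(1)
proof (induction k)
  case (Suc k)
  have "g k < n"
    using Suc.prems by simp
  moreover have "Suc (g k) mod n \<noteq> g k"
    using \<open>g k < n\<close> \<open>2 \<le> n\<close> by (cases "Suc (g k) = n") auto
  moreover have "Suc (g k) mod n < n"
    using \<open>2 \<le> n\<close> by simp
  ultimately show ?case
    using Suc.IH Suc.prems by (fastforce simp: hub_Suc rim_def)
qed simp

lemma ex_path_through_rim_edges:
  assumes "\<And>i. i < k \<Longrightarrow> g i < n" "2 \<le> n"
  shows "\<exists>p. is_dpath (chain n k m) p \<and> wlen (chain_weight n k) p = real k \<and>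
    tail n k m \<subseteq> path_edges p \<and> (\<forall>i<k. rim_edge n i (g i) \<in> path_edges p)"
proof -
  define p where "p = rim_walk n g k @ [hub n k..<hub n k + Suc m]"
  \<comment> \<open>Exposes the shared hub in the form in which \<open>path_edges_append\<close> and
    \<open>wlen_append\<close> cut a walk.\<close>
  have Cons: "[hub n k..<hub n k + Suc m] = hub n k # [Suc (hub n k)..<hub n k + Suc m]"
    by (simp add: upt_conv_Cons)
  have edges: "path_edges p = path_edges (rim_walk n g k @ [hub n k]) \<union> tail n k m"
    unfolding p_def tail_def path_edges_upt[symmetric] unfolding Cons by (rule path_edges_append)
  have "wlen (chain_weight n k) [hub n k..<hub n k + Suc m] = 0"
    by (rule wlen_eq_0) (simp only: path_edges_upt tail_def[symmetric] chain_weight_tail)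
  then have wlen: "wlen (chain_weight n k) p = real k"
    using assms(1) wlen_append[of "chain_weight n k" "rim_walk n g k" "hub n k"
        "[Suc (hub n k)..<hub n k + Suc m]"] wlen_rim_walk[of k g n k]
    unfolding p_def Cons by simp
  have "Suc j mod n < n" for j
    using \<open>2 \<le> n\<close> by simp
  moreover have "tail n k m \<subseteq> chain_edges n k m"
    by (simp add: chain_edges_def)
  ultimately have "path_edges p \<subseteq> chain_edges n k m"
    unfolding edges path_edges_rim_walk
    using assms(1) by (simp add: UN_subset_iff chain_edgesI)
  moreover have "distinct p" "set p \<subseteq> {..hub n k + m}"
    using rim_walk_distinct[of k g n, OF assms] unfolding p_def by (auto simp del: upt_Suc)
  moreover have "p \<noteq> []"
    by (simp add: p_def)
  ultimately have "is_dpath (chain n k m) p"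
    by (simp add: is_dpath_def is_walk_def chain_def)
  moreover have "rim_edge n i (g i) \<in> path_edges p" if "i < k" for i
    using that unfolding edges path_edges_rim_walk by blast
  ultimately show ?thesis
    using wlen edges by blast
qed

section \<open>The lower bound on the total size\<close>

text \<open>A diagonal argument over the list \<open>Ts\<close> of subgraphs containing the tail:
  whatever covers the diagonal path contains the tail, hence is some \<open>Ts ! i\<close>, yet it
  misses the edge chosen in cycle \<open>i\<close>.\<close>

lemma covers_tail_often:
  assumes H: "\<And>H. H \<in> set Hs \<Longrightarrow> is_subgraph H (chain n k m) \<and> clustered (chain_weight n k) D H"
    and cov: "\<And>p. is_dpath (chain n k m) p \<Longrightarrow> wlen (chain_weight n k) p \<le> real k \<Longrightarrow>
      \<exists>H\<in>set Hs. covers H p"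
    and "D < real n - 1" "2 \<le> n"
  shows "k < length (filter (\<lambda>H. tail n k m \<subseteq> snd H) Hs)"
proof (rule ccontr)
  define Ts where "Ts = filter (\<lambda>H. tail n k m \<subseteq> snd H) Hs"
  assume "\<not> k < length (filter (\<lambda>H. tail n k m \<subseteq> snd H) Hs)"
  then have len: "length Ts \<le> k"
    by (simp add: Ts_def)
  \<comment> \<open>The path needs a position in all \<open>k\<close> cycles, even if
    \<open>Ts\<close> is shorter; in the surplus cycles any position will do.\<close>
  have "\<exists>j<n. i < length Ts \<longrightarrow> rim_edge n i j \<notin> snd (Ts ! i)" if "i < k" for i
  proof (cases "i < length Ts")
    case True
    then have "Ts ! i \<in> set Hs"
      using nth_mem[of i Ts] by (auto simp: Ts_def)
    then obtain j where "j < n" "rim_edge n i j \<notin> snd (Ts ! i)"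
      using clustered_misses_rim_edge[of "Ts ! i" n k m D i] H assms(3,4) \<open>i < k\<close>
      by (metis less_le_trans zero_less_numeral)
    then show ?thesis by blast
  next
    case False
    then show ?thesis
      using \<open>2 \<le> n\<close> by (intro exI[of _ 0]) simp
  qed
  then obtain g where g: "\<And>i. i < k \<Longrightarrow> g i < n"
      "\<And>i. i < k \<Longrightarrow> i < length Ts \<Longrightarrow> rim_edge n i (g i) \<notin> snd (Ts ! i)"
    by metis
  obtain p where p: "is_dpath (chain n k m) p" "wlen (chain_weight n k) p = real k"
      "tail n k m \<subseteq> path_edges p" "\<And>i. i < k \<Longrightarrow> rim_edge n i (g i) \<in> path_edges p"
    using ex_path_through_rim_edges[of k g n m] g(1) \<open>2 \<le> n\<close> by metis
  obtain H where "H \<in> set Hs" "path_edges p \<subseteq> snd H"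
    using cov[of p] p by (auto simp: covers_def)
  then have "H \<in> set Ts"
    using p(3) by (auto simp: Ts_def)
  then obtain i where "i < length Ts" "H = Ts ! i"
    by (auto simp: in_set_conv_nth)
  then show False
    using g(2)[of i] p(4)[of i] len \<open>path_edges p \<subseteq> snd H\<close> by auto
qed

theorem theorem1p3:
  shows "\<exists>c1 c2 :: real. c1 > 0 \<and> c2 > 0 \<and>
    (\<forall>(m::nat) (lam::real). m \<ge> 1 \<longrightarrow> lam \<ge> 1 \<longrightarrow>
      (\<exists>G (w :: nat \<times> nat \<Rightarrow> real) (d::real).
         is_digraph G \<and> (\<forall>e \<in> snd G. w e \<ge> 0) \<and>
         real (card (snd G)) \<le> c1 * real m \<and>
         (\<forall>Hs :: (nat set \<times> (nat \<times> nat) set) list.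
            (\<forall>H \<in> set Hs. is_subgraph H G \<and> clustered w (d * lam) H) \<longrightarrow>
            (\<forall>p. is_dpath G p \<and> wlen w p \<le> d \<longrightarrow> (\<exists>H \<in> set Hs. covers H p)) \<longrightarrow>
            real (\<Sum>H \<leftarrow> Hs. card (snd H)) \<ge> c2 * real m * sqrt (real m / lam))))"
proof (rule exI[of _ 10], rule exI[of _ 1], intro conjI allI impI)
  fix m :: nat and lam :: real
  assume "1 \<le> m" "1 \<le> lam"
  define k where "k = nat \<lfloor>sqrt (real m / lam)\<rfloor>"
  \<comment> \<open>Adding 2 to the floor makes \<open>n - 1\<close> strictly larger than
    \<open>real k * lam\<close> and keeps \<open>2 \<le> n\<close> when
    \<open>k = 0\<close>.\<close>
  define n where "n = nat \<lfloor>real k * lam\<rfloor> + 2"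
  have k: "real k \<le> sqrt (real m / lam)" "sqrt (real m / lam) \<le> real k + 1"
    using \<open>1 \<le> lam\<close> by (auto simp: k_def; linarith)+
  have n: "real n \<le> real k * lam + 2" "real k * lam < real n - 1"
    using \<open>1 \<le> lam\<close> by (auto simp: n_def; linarith)+
  have "2 \<le> n"
    by (simp add: n_def)
  have "(real k)\<^sup>2 \<le> real m / lam"
    using k(1) \<open>1 \<le> lam\<close> by (metis of_nat_0_le_iff real_sqrt_ge_0_iff real_sqrt_le_iff real_sqrt_pow2 
        power_mono order_trans)
  then have kk: "real k * (real k * lam) \<le> real m"
    using \<open>1 \<le> lam\<close> by (simp add: field_simps power2_eq_square)
  \<comment> \<open>This bounds the contribution of the additive 2 in \<open>n\<close> to the number
    of edges.\<close>
  have "real k * 1 \<le> real k * (real k * lam)"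
  proof (cases k)
    case (Suc k')
    have "1 * 1 \<le> real k * lam"
      using Suc \<open>1 \<le> lam\<close> by (intro mult_mono) auto
    then show ?thesis by (intro mult_left_mono) auto
  qed simp
  with kk have "real k \<le> real m" by simp
  have "real (card (chain_edges n k m)) \<le> 3 * (real k * real n) + real m"
    using of_nat_mono[OF card_chain_edges_le[of n k m], where 'a = real] by simp
  also have "\<dots> \<le> 3 * (real k * (real k * lam + 2)) + real m"
    using n(1) by (intro add_mono mult_left_mono) auto
  \<comment> \<open>The three summands are at most \<open>3 * m\<close>, \<open>6 * m\<close> and
    \<open>m\<close>.\<close>
  also have "\<dots> \<le> 10 * real m"
    using kk \<open>real k \<le> real m\<close> by (simp add: algebra_simps)
  finally have card: "real (card (chain_edges n k m)) \<le> 10 * real m" .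
  have total: "1 * real m * sqrt (real m / lam) \<le> real (\<Sum>H \<leftarrow> Hs. card (snd H))"
    if H: "\<forall>H\<in>set Hs. is_subgraph H (chain n k m) \<and> clustered (chain_weight n k) (real k * lam) H"
      and cov: "\<forall>p. is_dpath (chain n k m) p \<and> wlen (chain_weight n k) p \<le> real k \<longrightarrow>
        (\<exists>H\<in>set Hs. covers H p)"
    for Hs
  proof -
    define Ts where "Ts = filter (\<lambda>H. tail n k m \<subseteq> snd H) Hs"
    have "k < length Ts"
      unfolding Ts_def using H cov n(2) \<open>2 \<le> n\<close> by (intro covers_tail_often) auto
    have "m \<le> card (snd H)" if "H \<in> set Ts" for H
    proof -
      have "tail n k m \<subseteq> snd H" "snd H \<subseteq> chain_edges n k m"
        using that H by (auto simp: Ts_def is_subgraph_def chain_def)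
      then show ?thesis
        using card_mono[of "snd H" "tail n k m"] finite_subset finite_chain_edges card_tail by metis
    qed
    then have "length Ts * m \<le> (\<Sum>H \<leftarrow> Ts. card (snd H))"
      using sum_list_mono[of Ts "\<lambda>_. m" "\<lambda>H. card (snd H)"] by (simp add: sum_list_triv)
    also have "\<dots> \<le> (\<Sum>H \<leftarrow> Hs. card (snd H))"
      unfolding Ts_def by (rule sum_list_filter_le_nat)
    finally have "real (length Ts) * real m \<le> real (\<Sum>H \<leftarrow> Hs. card (snd H))"
      by (metis of_nat_mono of_nat_mult)
    \<comment> \<open>The strict inequality \<open>k < length Ts\<close> makes up for rounding the
      square root down.\<close>
    moreover have "sqrt (real m / lam) * real m \<le> real (length Ts) * real m"
      using k(2) \<open>k < length Ts\<close> by (intro mult_right_mono) auto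
    ultimately show ?thesis by (simp add: mult.commute)
  qed
  show "\<exists>G w d. is_digraph G \<and> (\<forall>e \<in> snd G. w e \<ge> 0) \<and>
         real (card (snd G)) \<le> 10 * real m \<and>
         (\<forall>Hs :: (nat set \<times> (nat \<times> nat) set) list.
            (\<forall>H \<in> set Hs. is_subgraph H G \<and> clustered w (d * lam) H) \<longrightarrow>
            (\<forall>p. is_dpath G p \<and> wlen w p \<le> d \<longrightarrow> (\<exists>H \<in> set Hs. covers H p)) \<longrightarrow>
            real (\<Sum>H \<leftarrow> Hs. card (snd H)) \<ge> 1 * real m * sqrt (real m / lam))"
    using card total is_digraph_chain[of n k m] chain_weight_nonneg[of n k]
    by (intro exI[of _ "chain n k m"] exI[of _ "chain_weight n k"] exI[of _ "real k"])
      (simp add: chain_def)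
qed simp_all

end
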